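(* The following identities are satisfied in any bounded hoop: \[ \neg(x+y)=x\rightarrow\neg y,\qquad \neg(x\rightarrow y)=\neg\neg x+\neg y . \]
   Context: A pocrim is a structure $\mathbf{P}=(P;0,+,\rightarrow)$ such that, writing $x\ge y$ for $x\rightarrow y=0$: $(P;0,+)$ is a commutative monoid; $\ge$ is a partial order on $P$; $x\ge y$ implies $x+z\ge y+z$; $x\ge 0$ for all $x$; and $x+y\ge z$ iff $x\ge y\rightarrow z$. A hoop is a pocrim satisfying $x+(x\rightarrow y)=y+(y\rightarrow x)$. A pocrim is bounded if it has a (necessarily unique) element $1$ with $x+1=1$ for all $x$; then $\neg x$ denotes $x\rightarrow 1$. The operation $\neg$ binds more tightly than $+$, which binds more tightly than $\rightarrow$. *)

theory Defs
  imports Main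
begin

text \<open>
  A structure is given by a type \<open>'a\<close> (its universe) together with explicit operations.
  Note the order of the arguments in the order relation: \<open>x \<succeq> y\<close> means
  \<open>x \<rightarrow> y = 0\<close>, so \<open>0\<close> is the least element.
\<close>

definition pocrim_ge :: "'a \<Rightarrow> ('a \<Rightarrow> 'a \<Rightarrow> 'a) \<Rightarrow> 'a \<Rightarrow> 'a \<Rightarrow> bool"
  where "pocrim_ge zero imp x y \<longleftrightarrow> imp x y = zero"

definition pocrim_neg :: "('a \<Rightarrow> 'a \<Rightarrow> 'a) \<Rightarrow> 'a \<Rightarrow> 'a \<Rightarrow> 'a"
  where "pocrim_neg imp one x = imp x one"

locale pocrim = comm_monoid plus zero
  for zero :: 'a  (\<open>\<zero>\<close>)
    and plus :: "'a \<Rightarrow> 'a \<Rightarrow> 'a"  (infixl \<open>\<oplus>\<close> 65)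
    and imp :: "'a \<Rightarrow> 'a \<Rightarrow> 'a"  (infixr \<open>\<rightarrow>\<close> 60) +
  assumes ge_refl: "reflp (pocrim_ge \<zero> (\<rightarrow>))"
    and ge_antisym: "antisymp (pocrim_ge \<zero> (\<rightarrow>))"
    and ge_trans: "transp (pocrim_ge \<zero> (\<rightarrow>))"
    and plus_mono: "pocrim_ge \<zero> (\<rightarrow>) x y \<Longrightarrow> pocrim_ge \<zero> (\<rightarrow>) (x \<oplus> z) (y \<oplus> z)"
    and ge_zero: "pocrim_ge \<zero> (\<rightarrow>) x \<zero>"
    and residuation: "pocrim_ge \<zero> (\<rightarrow>) (x \<oplus> y) z \<longleftrightarrow> pocrim_ge \<zero> (\<rightarrow>) x (y \<rightarrow> z)"

locale hoop = pocrim +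
  assumes divisibility: "x \<oplus> (x \<rightarrow> y) = y \<oplus> (y \<rightarrow> x)"

text \<open>
  Boundedness asks for an annihilating element; it is unique
  (if \<open>1\<close> and \<open>1'\<close> both annihilate, then \<open>1 = 1' \<oplus> 1 = 1 \<oplus> 1' = 1'\<close>),
  so taking it as a parameter is the same as asking for its existence.
\<close>

locale bounded_pocrim = pocrim +
  fixes one :: 'a  (\<open>\<one>\<close>)
  assumes plus_one: "x \<oplus> \<one> = \<one>"

locale bounded_hoop = hoop + bounded_pocrim

end

theory Submission
  imports Defs
begin

text \<open>
  The first identity is residuation. For the second, call \<open>d\<close> dense if \<open>\<not>d = 1\<close>. In a
  bounded hoop \<open>\<not>\<not>x \<rightarrow> x\<close> is always dense; prefixing with \<open>x\<close> therefore gives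
  \<open>\<not>(x \<rightarrow> y) = \<not>(x \<rightarrow> \<not>\<not>y) = \<not>\<not>(\<not>\<not>x + \<not>y)\<close>. It remains to see that a sum \<open>a + b\<close> of
  negations equals \<open>z = \<not>\<not>(a + b)\<close>. Put \<open>d = z \<rightarrow> a + b\<close>. Density of \<open>d\<close> yields
  \<open>d \<rightarrow> z = z\<close>. From \<open>z \<ge> a\<close> and \<open>z \<ge> b\<close> we get \<open>z + z \<ge> a + b\<close>, i.e. \<open>z \<ge> d\<close>. Hence
  \<open>z = z + (z \<rightarrow> d) = d + (d \<rightarrow> z) = d + z \<ge> a + b\<close>.
\<close>

context pocrim
begin

abbreviation ge :: "'a \<Rightarrow> 'a \<Rightarrow> bool"  (infix \<open>\<succeq>\<close> 50)
  where "x \<succeq> y \<equiv> pocrim_ge \<zero> (\<rightarrow>) x y"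

lemma refl [simp]: "x \<succeq> x"
  using ge_refl by (rule reflpD)

lemma trans [trans]: "x \<succeq> y \<Longrightarrow> y \<succeq> z \<Longrightarrow> x \<succeq> z"
  using ge_trans by (rule transpD)

lemma antisym: "x \<succeq> y \<Longrightarrow> y \<succeq> x \<Longrightarrow> x = y"
  using ge_antisym by (rule antisympD)

lemma plus_mono2: "a \<succeq> b \<Longrightarrow> c \<succeq> d \<Longrightarrow> a \<oplus> c \<succeq> b \<oplus> d"
  by (metis plus_mono commute trans)

lemma plus_ge_left: "x \<oplus> y \<succeq> x"
  using plus_mono2[OF refl ge_zero, of x y] by simp

lemma plus_ge_right: "x \<oplus> y \<succeq> y"
  using plus_ge_left[of y x] by (simp add: commute)

lemma imp_iff: "x \<succeq> y \<rightarrow> z \<longleftrightarrow> x \<oplus> y \<succeq> z"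
  by (simp add: residuation)

lemma modus_ponens: "(x \<rightarrow> y) \<oplus> x \<succeq> y"
  using imp_iff[of "x \<rightarrow> y" x y] by simp

lemma ge_imp: "y \<succeq> x \<rightarrow> y"
  by (simp add: imp_iff plus_ge_left)

lemma imp_plus: "x \<oplus> y \<rightarrow> z = x \<rightarrow> y \<rightarrow> z"
proof (rule antisym)
  show "x \<oplus> y \<rightarrow> z \<succeq> x \<rightarrow> y \<rightarrow> z"
    using modus_ponens[of "x \<oplus> y" z] by (simp add: imp_iff assoc)
  show "x \<rightarrow> y \<rightarrow> z \<succeq> x \<oplus> y \<rightarrow> z"
    using modus_ponens[of x "y \<rightarrow> z"] by (simp add: imp_iff assoc)
qed

lemma imp_comm: "x \<rightarrow> y \<rightarrow> z = y \<rightarrow> x \<rightarrow> z"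
  by (metis commute imp_plus)

lemma imp_antimono: "x \<succeq> y \<Longrightarrow> y \<rightarrow> z \<succeq> x \<rightarrow> z"
  unfolding imp_iff by (metis plus_mono2 refl modus_ponens trans)

lemma imp_mono: "y \<succeq> z \<Longrightarrow> x \<rightarrow> y \<succeq> x \<rightarrow> z"
  unfolding imp_iff by (metis modus_ponens trans)

lemma imp_trans: "(y \<rightarrow> z) \<oplus> (x \<rightarrow> y) \<succeq> x \<rightarrow> z"
  unfolding imp_iff by (metis assoc plus_mono2 refl modus_ponens trans)

end

context hoop
begin

text \<open>Here \<open>x \<rightarrow> y\<close> is \<open>\<zero>\<close>, so one side of
  divisibility collapses to \<open>x\<close>.\<close>

lemma divides_of_ge: "x \<succeq> y \<Longrightarrow> y \<oplus> (y \<rightarrow> x) = x"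
  using divisibility[of x y] by (simp add: pocrim_ge_def)

end

context bounded_pocrim
begin

abbreviation neg :: "'a \<Rightarrow> 'a"  (\<open>\<sim> _\<close> [80] 80)
  where "\<sim> x \<equiv> pocrim_neg (\<rightarrow>) \<one> x"

lemma one_ge: "\<one> \<succeq> x"
  using plus_ge_left[of x \<one>] by (simp add: plus_one)

lemma ge_one_iff: "x \<succeq> \<one> \<longleftrightarrow> x = \<one>"
  using antisym one_ge by auto

lemma ge_neg_iff: "x \<succeq> \<sim> y \<longleftrightarrow> x \<oplus> y = \<one>"
  by (simp add: pocrim_neg_def imp_iff ge_one_iff)

lemma neg_plus_self: "\<sim> x \<oplus> x = \<one>"
  using ge_neg_iff[of "\<sim> x" x] by simp

lemma neg_plus: "\<sim> (x \<oplus> y) = x \<rightarrow> \<sim> y"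
  by (simp add: pocrim_neg_def imp_plus)

lemma neg_antimono: "x \<succeq> y \<Longrightarrow> \<sim> y \<succeq> \<sim> x"
  by (simp add: pocrim_neg_def imp_antimono)

lemma ge_neg_neg: "x \<succeq> \<sim> \<sim> x"
  by (metis ge_neg_iff commute neg_plus_self)

lemma neg_neg_neg: "\<sim> \<sim> \<sim> x = \<sim> x"
  by (metis antisym ge_neg_neg neg_antimono)

text \<open>Both sides equal \<open>\<sim> y \<rightarrow> \<sim> x\<close>: contraposition sees
  \<open>x\<close> only through \<open>\<sim> x\<close>, which is also
  \<open>\<sim> \<sim> \<sim> x\<close>.\<close>

lemma imp_neg_neg: "x \<rightarrow> \<sim> \<sim> y = \<sim> (\<sim> \<sim> x \<oplus> \<sim> y)"
  by (metis neg_plus commute neg_neg_neg)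

text \<open>Exchanging premises turns \<open>d \<rightarrow> w \<rightarrow> \<one>\<close> into
  \<open>w \<rightarrow> \<sim> d\<close>, which is \<open>w \<rightarrow> \<one>\<close>.\<close>

lemma dense_imp_neg:
  assumes "\<sim> d = \<one>"
  shows "d \<rightarrow> \<sim> w = \<sim> w"
  by (metis assms neg_plus commute neg_neg_neg pocrim_neg_def plus_one imp_comm)

end

context bounded_hoop
begin

lemma neg_neg_imp_self_dense: "\<sim> (\<sim> \<sim> x \<rightarrow> x) = \<one>"
proof -
  define d where "d = \<sim> \<sim> x \<rightarrow> x"
  have x: "\<sim> \<sim> x \<oplus> d = x"
    unfolding d_def by (rule divides_of_ge[OF ge_neg_neg])
  \<comment> \<open>Negating the factorization of \<open>x\<close> gives
    \<open>\<sim> x = d \<rightarrow> \<sim> \<sim> \<sim> x\<close>. By divisibility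
    \<open>\<sim> x\<close> then absorbs \<open>d\<close>.\<close>
  have "d \<rightarrow> \<sim> x = \<sim> x"
    using neg_plus[of d "\<sim> \<sim> x"] by (simp add: commute[of d] x neg_neg_neg)
  moreover have "\<sim> x \<succeq> d"
    unfolding d_def by (simp add: imp_iff commute[of "\<sim> x"] neg_plus_self one_ge)
  ultimately have dx: "d \<oplus> \<sim> x = \<sim> x"
    using divides_of_ge by metis
  have "\<sim> d \<succeq> \<sim> x"
    unfolding d_def by (rule neg_antimono[OF ge_imp])
  then have "\<sim> d = \<sim> x \<oplus> (\<sim> x \<rightarrow> \<sim> d)"
    by (simp add: divides_of_ge)
  \<comment> \<open>The left side is \<open>\<sim> (\<sim> x \<oplus> d)\<close>, and
    \<open>\<sim> x\<close> absorbs \<open>d\<close>.\<close>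
  also have "\<sim> x \<rightarrow> \<sim> d = \<sim> \<sim> x"
    using neg_plus[of "\<sim> x" d] dx by (simp add: commute)
  also have "\<sim> x \<oplus> \<sim> \<sim> x = \<one>"
    using neg_plus_self[of "\<sim> x"] by (simp add: commute)
  finally show ?thesis
    by (simp add: d_def)
qed

lemma neg_neg_plus_neg: "\<sim> \<sim> (\<sim> x \<oplus> \<sim> y) = \<sim> x \<oplus> \<sim> y"
proof (rule antisym)
  define p where "p = \<sim> x \<oplus> \<sim> y"
  define z where "z = \<sim> \<sim> p"
  define d where "d = z \<rightarrow> p"
  \<comment> \<open>Double negation is monotone and fixes negations, so the lower bounds
    \<open>\<sim> x\<close> and \<open>\<sim> y\<close> of \<open>p\<close> remain lower bounds of
    \<open>z\<close>.\<close>
  have "z \<succeq> \<sim> x"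
    using neg_antimono[OF neg_antimono[OF plus_ge_left[of "\<sim> x" "\<sim> y"]]]
    by (simp add: z_def p_def neg_neg_neg)
  moreover have "z \<succeq> \<sim> y"
    using neg_antimono[OF neg_antimono[OF plus_ge_right[of "\<sim> x" "\<sim> y"]]]
    by (simp add: z_def p_def neg_neg_neg)
  ultimately have "z \<succeq> d"
    unfolding d_def imp_iff p_def by (rule plus_mono2)
  moreover have "d \<rightarrow> z = z"
    using neg_neg_imp_self_dense[of p] by (simp add: d_def z_def dense_imp_neg)
  ultimately have "d \<oplus> z = z"
    using divides_of_ge by metis
  then show "\<sim> \<sim> (\<sim> x \<oplus> \<sim> y) \<succeq> \<sim> x \<oplus> \<sim> y"
    using modus_ponens[of z p] by (simp add: d_def z_def p_def)
qed (rule ge_neg_neg)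

lemma neg_imp: "\<sim> (x \<rightarrow> y) = \<sim> \<sim> x \<oplus> \<sim> y"
proof -
  define d where "d = \<sim> \<sim> y \<rightarrow> y"
  have "d \<succeq> (x \<rightarrow> \<sim> \<sim> y) \<rightarrow> (x \<rightarrow> y)"
    unfolding d_def imp_iff[of _ "x \<rightarrow> \<sim> \<sim> y"] by (rule imp_trans)
  then have "x \<rightarrow> \<sim> \<sim> y \<succeq> d \<rightarrow> (x \<rightarrow> y)"
    by (simp add: imp_iff commute)
  also have "\<dots> \<succeq> d \<rightarrow> \<sim> \<sim> (x \<rightarrow> y)"
    by (rule imp_mono[OF ge_neg_neg])
  also have "\<dots> = \<sim> \<sim> (x \<rightarrow> y)"
    unfolding d_def by (rule dense_imp_neg[OF neg_neg_imp_self_dense])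
  finally have "\<sim> (x \<rightarrow> y) \<succeq> \<sim> (x \<rightarrow> \<sim> \<sim> y)"
    using neg_antimono neg_neg_neg by metis
  moreover have "\<sim> (x \<rightarrow> \<sim> \<sim> y) \<succeq> \<sim> (x \<rightarrow> y)"
    by (rule neg_antimono[OF imp_mono[OF ge_neg_neg]])
  ultimately have "\<sim> (x \<rightarrow> y) = \<sim> (x \<rightarrow> \<sim> \<sim> y)"
    by (rule antisym)
  then show ?thesis
    by (simp add: imp_neg_neg neg_neg_plus_neg)
qed

end

theorem theorem4p3p1:
  fixes zero :: 'a  (\<open>\<zero>\<close>)
    and plus :: "'a \<Rightarrow> 'a \<Rightarrow> 'a"  (infixl \<open>\<oplus>\<close> 65)
    and imp :: "'a \<Rightarrow> 'a \<Rightarrow> 'a"  (infixr \<open>\<rightarrow>\<close> 60)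
    and one :: 'a  (\<open>\<one>\<close>)
    and x y :: 'a
  assumes "bounded_hoop \<zero> (\<oplus>) (\<rightarrow>) \<one>"
  shows "pocrim_neg (\<rightarrow>) \<one> (x \<oplus> y) = x \<rightarrow> pocrim_neg (\<rightarrow>) \<one> y
       \<and> pocrim_neg (\<rightarrow>) \<one> (x \<rightarrow> y)
         = pocrim_neg (\<rightarrow>) \<one> (pocrim_neg (\<rightarrow>) \<one> x) \<oplus> pocrim_neg (\<rightarrow>) \<one> y"
proof -
  interpret bounded_hoop \<zero> "(\<oplus>)" "(\<rightarrow>)" \<one>
    by (rule assms)
  show ?thesis
    by (simp add: neg_plus neg_imp)
qed

end
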